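(* Let $K$ be an infinite field, $n\ge 2$, and $S=K[x_1,\ldots,x_n]$. If $I\subset S$ is a $\mathcal{D}$-fixed ideal, then $I$ is an ideal of Borel type.
   Context: A $\mathbf{d}$-sequence is a finite strictly increasing sequence of positive integers $\mathbf{d}: 1=d_0\mid d_1\mid\cdots\mid d_s$ (each dividing the next). Every $a\in\mathbb{N}$ has a unique $\mathbf{d}$-decomposition $a=\sum_{t=0}^s a_td_t$ with nonnegative integers $a_t$ and $0\le a_t<d_{t+1}/d_t$ for $0\le t<s$. For $a=\sum a_td_t$ and $b=\sum b_td_t$ so decomposed, write $a\le_{\mathbf{d}}b$ if $a_t\le b_t$ for all $0\le t\le s$. A monomial ideal $I\subset S$ is $\mathbf{d}$-fixed if for every monomial $u\in I$ and all $1\le j<i\le n$, if $t\le_{\mathbf{d}}\nu_i(u)$ then $u\cdot x_j^t/x_i^t\in I$, where $\nu_i(u)$ is the exponent of $x_i$ in $u$. A monomial ideal is $\mathcal{D}$-fixed if it is a sum of $\mathbf{d}$-fixed ideals, for various $\mathbf{d}$-sequences (different summands may use different $\mathbf{d}$-sequences). A monomial ideal $I\subset S$ is of Borel type if $(I:x_j^\infty)=(I:(x_1,\ldots,x_j)^\infty)$ for all $j=1,\ldots,n$, where $(I:J^\infty)=\bigcup_{k\ge 1}(I:J^k)$. *)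

theory Defs
  imports Complex_Main "HOL-Library.Poly_Mapping" "HOL-Library.Cardinality"
begin

(* The polynomial ring K[x_1,...,x_n]: the index set {1 < ... < n} of the variables is a type
   'n :: {finite, linorder}; a key of type 'n =>0 nat is the exponent vector of a monomial. *)
type_synonym ('n, 'k) mpoly = "('n \<Rightarrow>\<^sub>0 nat) \<Rightarrow>\<^sub>0 'k"

definition monomial :: "('n \<Rightarrow>\<^sub>0 nat) \<Rightarrow> ('n, 'k::comm_ring_1) mpoly" where
  "monomial u = Poly_Mapping.single u 1"

definition var :: "'n \<Rightarrow> ('n, 'k::comm_ring_1) mpoly" where
  "var i = monomial (Poly_Mapping.single i 1)"


(* Ideals of a commutative ring are its submodules as a module over itself. *)
lemma module_times: "module ((*) :: 'a \<Rightarrow> 'a \<Rightarrow> 'a::comm_ring_1)"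
  by unfold_locales (simp_all add: algebra_simps)

definition ideal_gen :: "'a::comm_ring_1 set \<Rightarrow> 'a set" where
  "ideal_gen B = module.span (*) B"

definition ideal_times :: "'a::comm_ring_1 set \<Rightarrow> 'a set \<Rightarrow> 'a set" where
  "ideal_times I J = ideal_gen {f * g | f g. f \<in> I \<and> g \<in> J}"

primrec ideal_pow :: "'a::comm_ring_1 set \<Rightarrow> nat \<Rightarrow> 'a set" where
  "ideal_pow J 0 = UNIV"
| "ideal_pow J (Suc k) = ideal_times J (ideal_pow J k)"

definition ideal_colon :: "'a::comm_ring_1 set \<Rightarrow> 'a set \<Rightarrow> 'a set" where
  "ideal_colon I J = {f. \<forall>g\<in>J. f * g \<in> I}"

definition saturation :: "'a::comm_ring_1 set \<Rightarrow> 'a set \<Rightarrow> 'a set" where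
  "saturation I J = (\<Union>k\<in>{1..}. ideal_colon I (ideal_pow J k))"

definition monomial_ideal :: "('n, 'k::comm_ring_1) mpoly set \<Rightarrow> bool" where
  "monomial_ideal I \<longleftrightarrow> (\<exists>M. I = ideal_gen (monomial ` M))"


(* The list [d_0, ..., d_s]; its length is s + 1. *)
definition d_sequence :: "nat list \<Rightarrow> bool" where
  "d_sequence d \<longleftrightarrow> d \<noteq> [] \<and> d ! 0 = 1 \<and>
     (\<forall>t. Suc t < length d \<longrightarrow> d ! t < d ! Suc t \<and> d ! t dvd d ! Suc t)"

(* The last coefficient is unbounded. *)
definition d_decomposition :: "nat list \<Rightarrow> nat \<Rightarrow> nat list \<Rightarrow> bool" where
  "d_decomposition d a as \<longleftrightarrow> length as = length d \<and>
     a = (\<Sum>t<length d. as ! t * d ! t) \<and>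
     (\<forall>t. Suc t < length d \<longrightarrow> as ! t < d ! Suc t div d ! t)"

(* Decompositions with respect to a d-sequence exist and are unique, so the existential
   quantifiers pick out the decompositions of a and b. *)
definition d_le :: "nat list \<Rightarrow> nat \<Rightarrow> nat \<Rightarrow> bool" where
  "d_le d a b \<longleftrightarrow> (\<exists>as bs. d_decomposition d a as \<and> d_decomposition d b bs \<and>
     (\<forall>t<length d. as ! t \<le> bs ! t))"

(* Subtraction of exponent vectors truncates at 0; here t is at most the exponent of x_i in u
   because d_le d t b implies t \<le> b, so the exponent vector is that of u x_j^t / x_i^t. *)
definition d_fixed :: "nat list \<Rightarrow> ('n::linorder, 'k::comm_ring_1) mpoly set \<Rightarrow> bool" where
  "d_fixed d I \<longleftrightarrow> monomial_ideal I \<and>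
     (\<forall>u. monomial u \<in> I \<longrightarrow>
       (\<forall>i j t. j < i \<longrightarrow> d_le d t (Poly_Mapping.lookup u i) \<longrightarrow>
         monomial (u + Poly_Mapping.single j t - Poly_Mapping.single i t) \<in> I))"

(* The sum of a family of ideals is the ideal generated by their union. *)
definition D_fixed :: "('n::linorder, 'k::comm_ring_1) mpoly set \<Rightarrow> bool" where
  "D_fixed I \<longleftrightarrow> monomial_ideal I \<and>
     (\<exists>F. (\<forall>J\<in>F. \<exists>d. d_sequence d \<and> d_fixed d J) \<and> I = ideal_gen (\<Union>F))"

definition borel_type :: "('n::linorder, 'k::comm_ring_1) mpoly set \<Rightarrow> bool" where
  "borel_type I \<longleftrightarrow> monomial_ideal I \<and>
     (\<forall>j. saturation I (ideal_gen {var j}) = saturation I (ideal_gen (var ` {..j})))"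

end

theory Submission
  imports Defs
begin

text \<open>
  Every number has a \<open>d\<close>-decomposition, so \<open>\<le>\<^sub>d\<close> is reflexive and in a \<open>d\<close>-fixed ideal
  the whole power of \<open>x\<^sub>j\<close> in a monomial can be traded for the same power of \<open>x\<^sub>i\<close> with \<open>i < j\<close>.
  A monomial of a sum of monomial ideals lies in one of the summands. Hence if \<open>w x\<^sub>j\<^sup>k \<in> I\<close>
  for a monomial \<open>w\<close> then \<open>w x\<^sub>i\<^sup>N \<in> I\<close> for all \<open>i \<le> j\<close> and \<open>N\<close> large, and a power of
  \<open>(x\<^sub>1, \<dots>, x\<^sub>j)\<close> multiplies \<open>w\<close> into \<open>I\<close>.
\<close>

section \<open>Ideals\<close>

lemmas ideal_gen_base = module.span_base[OF module_times, folded ideal_gen_def]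
lemmas ideal_gen_zero = module.span_zero[OF module_times, folded ideal_gen_def]
lemmas ideal_gen_add = module.span_add[OF module_times, folded ideal_gen_def]
lemmas ideal_gen_mult = module.span_scale[OF module_times, folded ideal_gen_def]
lemmas ideal_gen_sum = module.span_sum[OF module_times, folded ideal_gen_def]
lemmas ideal_gen_mono = module.span_mono[OF module_times, folded ideal_gen_def]
lemmas ideal_gen_induct =
  module.span_induct_alt[OF module_times, folded ideal_gen_def, consumes 1, case_names zero step]

lemma ideal_gen_mult_right: "f \<in> ideal_gen B \<Longrightarrow> f * g \<in> ideal_gen B"
  using ideal_gen_mult[of f B g] by (simp add: mult.commute)

lemma ideal_times_mono: "I \<subseteq> I' \<Longrightarrow> J \<subseteq> J' \<Longrightarrow> ideal_times I J \<subseteq> ideal_times I' J'"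
  unfolding ideal_times_def by (intro ideal_gen_mono) blast

lemma ideal_pow_mono: "J \<subseteq> J' \<Longrightarrow> ideal_pow J k \<subseteq> ideal_pow J' k"
  by (induction k) (simp_all add: ideal_times_mono)

lemma saturation_antimono: "J \<subseteq> J' \<Longrightarrow> saturation I J' \<subseteq> saturation I J"
  using ideal_pow_mono[of J J'] unfolding saturation_def ideal_colon_def by blast

lemma power_in_ideal_pow: "a \<in> J \<Longrightarrow> a ^ k \<in> ideal_pow J k"
  by (induction k) (auto simp: ideal_times_def intro!: ideal_gen_base)

text \<open>The \<open>g\<close> with \<open>f * g \<in> ideal_gen I\<close> form an ideal, so
  testing generators suffices.\<close>

lemma mult_ideal_gen_subset:
  assumes "\<And>b. b \<in> B \<Longrightarrow> f * b \<in> ideal_gen I" "g \<in> ideal_gen B"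
  shows "f * g \<in> ideal_gen I"
  using assms(2)
proof (induction rule: ideal_gen_induct)
  case zero
  then show ?case by (simp add: ideal_gen_zero)
next
  case (step c b g)
  then have "c * (f * b) + f * g \<in> ideal_gen I"
    using assms(1) by (blast intro: ideal_gen_add ideal_gen_mult)
  then show ?case by (simp add: algebra_simps)
qed

text \<open>Induction on the sum of the exponents: a factor \<open>a\<close> split off from the power of the ideal
  is absorbed into \<open>f\<close> and lowers the exponent of \<open>a\<close>.\<close>
lemma mult_ideal_pow_subset:
  assumes "finite A" "A \<noteq> {}" "\<And>a. a \<in> A \<Longrightarrow> f * a ^ e a \<in> ideal_gen B"
    "g \<in> ideal_pow (ideal_gen A) (sum e A)"
  shows "f * g \<in> ideal_gen B"
  using assms
proof (induction "sum e A" arbitrary: f e g)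
  case 0
  \<comment> \<open>\<open>A\<close> is nonempty and all exponents vanish, so any
    \<open>a \<in> A\<close> gives \<open>f * a ^ 0 = f\<close>.\<close>
  then have "f \<in> ideal_gen B" by fastforce
  then show ?case by (rule ideal_gen_mult_right)
next
  case (Suc k)
  \<comment> \<open>A zero exponent is settled directly: lowering it would be truncated and leave
    the sum unchanged.\<close>
  show ?case
  proof (cases "\<exists>a\<in>A. e a = 0")
    case True
    with Suc.prems(3) have "f \<in> ideal_gen B" by fastforce
    then show ?thesis by (rule ideal_gen_mult_right)
  next
    case False
    have absorb: "f * a * g' \<in> ideal_gen B"
      if a: "a \<in> A" and g': "g' \<in> ideal_pow (ideal_gen A) k" for a g'
    proof -
      let ?e = "e(a := e a - 1)"
      have "sum ?e A = ?e a + sum ?e (A - {a})" "sum e A = e a + sum e (A - {a})"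
        using a \<open>finite A\<close> by (simp_all only: sum.remove)
      moreover have "sum ?e (A - {a}) = sum e (A - {a})" by (rule sum.cong) auto
      ultimately have k: "k = sum ?e A" using False a Suc.hyps(2) by auto
      have "f * a * b ^ ?e b \<in> ideal_gen B" if "b \<in> A" for b
      proof (cases "b = a")
        case True
        moreover have "f * a * a ^ (e a - 1) = f * a ^ e a"
          using False a by (cases "e a") (auto simp: mult.assoc)
        ultimately show ?thesis using Suc.prems(3)[OF a] by simp
      next
        case False
        then show ?thesis
          using ideal_gen_mult[OF Suc.prems(3)[OF that], of a]
          by (simp only: mult_ac fun_upd_other simp_thms)
      qed
      moreover have "g' \<in> ideal_pow (ideal_gen A) (sum ?e A)" using g' k by (simp only:)
      ultimately show ?thesis by (rule Suc.hyps(1)[OF k Suc.prems(1,2)])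
    qed
    have "f * (h * g') \<in> ideal_gen B"
      if "h \<in> ideal_gen A" "g' \<in> ideal_pow (ideal_gen A) k" for h g'
    proof -
      \<comment> \<open>With \<open>h\<close> as the last factor, only the generators of
        \<open>ideal_gen A\<close> need testing, and \<open>absorb\<close> handles these.\<close>
      have "(f * g') * h \<in> ideal_gen B"
        using that(1)
      proof (rule mult_ideal_gen_subset[rotated])
        show "f * g' * a \<in> ideal_gen B" if "a \<in> A" for a
          using absorb[OF that \<open>g' \<in> _\<close>] by (simp only: mult_ac)
      qed
      then show ?thesis by (simp only: mult_ac)
    qed
    moreover have "g \<in> ideal_gen {h * g' | h g'. h \<in> ideal_gen A \<and> g' \<in> ideal_pow (ideal_gen A) k}"
      using Suc.prems(4) by (simp flip: Suc.hyps(2) add: ideal_times_def)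
    ultimately show ?thesis by (elim mult_ideal_gen_subset[rotated]) blast
  qed
qed

section \<open>Monomials\<close>

lemma monomial_add: "monomial (u + v) = monomial u * monomial v"
  by (simp add: monomial_def mult_single)

lemma var_power: "var i ^ k = monomial (Poly_Mapping.single i k)"
  by (induction k) (simp_all add: var_def monomial_def mult_single flip: single_add)

lemma monomial_in_ideal_gen_add:
  "monomial u \<in> ideal_gen B \<Longrightarrow> monomial (u + v) \<in> ideal_gen B"
  by (simp add: monomial_add ideal_gen_mult_right)

text \<open>Cancellation only removes monomials: each key of a combination of elements of
  \<open>B\<close> is a multiple of a key of one of them, and \<open>P\<close> passes to
  multiples.\<close>

lemma keys_ideal_gen:
  fixes B :: "('n, 'k::comm_ring_1) mpoly set"
  assumes B: "\<And>b w. b \<in> B \<Longrightarrow> w \<in> Poly_Mapping.keys b \<Longrightarrow> P w"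
    and up: "\<And>w v. P w \<Longrightarrow> P (w + v)"
    and "f \<in> ideal_gen B" "w \<in> Poly_Mapping.keys f"
  shows "P w"
  using assms(3,4)
proof (induction arbitrary: w rule: ideal_gen_induct)
  case zero
  then show ?case by simp
next
  case (step c b g)
  then consider "w \<in> Poly_Mapping.keys (b * c)" | "w \<in> Poly_Mapping.keys g"
    using keys_add[of "c * b" g] by (auto simp: mult.commute)
  then show ?case
  proof cases
    case 1
    then obtain u v where "u \<in> Poly_Mapping.keys b" "w = u + v" using keys_mult[of b c] by auto
    with up B step.hyps show ?thesis by blast
  next
    case 2
    then show ?thesis by (rule step.IH)
  qed
qed

lemma monomial_ideal_keys:
  fixes I :: "('n, 'k::comm_ring_1) mpoly set"
  assumes "monomial_ideal I" "f \<in> I" "w \<in> Poly_Mapping.keys f"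
  shows "monomial w \<in> I"
proof -
  obtain M where I: "I = ideal_gen (monomial ` M)" using assms(1) by (auto simp: monomial_ideal_def)
  show ?thesis unfolding I
  proof (rule keys_ideal_gen[OF _ _ assms(2)[unfolded I] assms(3)])
    fix b :: "('n, 'k) mpoly" and w
    assume "b \<in> monomial ` M" "w \<in> Poly_Mapping.keys b"
    then have "w \<in> M" by (auto simp: monomial_def split: if_splits)
    then show "monomial w \<in> ideal_gen (monomial ` M)" by (simp add: ideal_gen_base)
  qed (rule monomial_in_ideal_gen_add)
qed

text \<open>Lying in some \<open>J \<in> F\<close> is a property of monomials that passes to
  multiples and holds for all keys of elements of \<open>\<Union>F\<close>, each \<open>J\<close>
  being monomial.\<close>

lemma monomial_in_sum_ideals:
  fixes F :: "('n, 'k::comm_ring_1) mpoly set set"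
  assumes F: "\<And>J. J \<in> F \<Longrightarrow> monomial_ideal J" and u: "monomial u \<in> ideal_gen (\<Union>F)"
  shows "\<exists>J\<in>F. monomial u \<in> J"
proof (rule keys_ideal_gen[OF _ _ u])
  show "\<exists>J\<in>F. monomial w \<in> J" if "b \<in> \<Union>F" "w \<in> Poly_Mapping.keys b" for b w
    using that F monomial_ideal_keys by blast
  show "\<exists>J\<in>F. monomial (w + v) \<in> J" if "\<exists>J\<in>F. monomial w \<in> J" for w v
    using that F unfolding monomial_ideal_def by (metis monomial_in_ideal_gen_add)
  show "u \<in> Poly_Mapping.keys (monomial u :: ('n, 'k) mpoly)" by (simp add: monomial_def)
qed

lemma sum_monomials:
  "f = (\<Sum>w\<in>Poly_Mapping.keys f. Poly_Mapping.single 0 (Poly_Mapping.lookup f w) * monomial w)"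
  by (rule poly_mapping_eqI)
    (simp add: monomial_def mult_single lookup_sum lookup_single when_def in_keys_iff)

text \<open>The shift of exponents is injective, so no terms cancel.\<close>

lemma lookup_mult_monomial:
  "Poly_Mapping.lookup (f * monomial v) (w + v) = Poly_Mapping.lookup f w"
proof -
  have "f * monomial v = (\<Sum>u\<in>Poly_Mapping.keys f. Poly_Mapping.single (u + v) (Poly_Mapping.lookup f u))"
    by (subst sum_monomials[of f]) (simp add: sum_distrib_right monomial_def mult_single)
  then show ?thesis by (simp add: lookup_sum lookup_single when_def in_keys_iff)
qed

lemma mult_mem_ideal_gen:
  fixes f :: "('n, 'k::comm_ring_1) mpoly"
  assumes "\<And>w. w \<in> Poly_Mapping.keys f \<Longrightarrow> monomial w * g \<in> ideal_gen B"
  shows "f * g \<in> ideal_gen B"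
proof -
  have "f * g = (\<Sum>w\<in>Poly_Mapping.keys f.
      Poly_Mapping.single 0 (Poly_Mapping.lookup f w) * (monomial w * g))"
    by (subst sum_monomials[of f]) (simp add: sum_distrib_right mult.assoc)
  also have "\<dots> \<in> ideal_gen B" by (intro ideal_gen_sum ideal_gen_mult[of "monomial _ * g"] assms)
  finally show ?thesis .
qed

section \<open>Fixed ideals\<close>

lemma d_sequence_pos: "d_sequence d \<Longrightarrow> t < length d \<Longrightarrow> 0 < d ! t"
  by (induction t) (auto simp: d_sequence_def)

text \<open>The digit at a position \<open>t\<close> below the last is \<open>(a mod d\<^sub>t\<^sub>+\<^sub>1) div d\<^sub>t\<close>, and the terms below
  position \<open>t\<close> add up to \<open>a mod d\<^sub>t\<close>.\<close>
lemma d_decomposition_exists: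
  assumes d: "d_sequence d"
  shows "\<exists>as. d_decomposition d a as"
proof -
  obtain s where s: "length d = Suc s" using d by (cases d) (auto simp: d_sequence_def)
  define c where "c t = (if t < s then a mod d ! Suc t div d ! t else a div d ! t)" for t
  have partial: "(\<Sum>r<t. c r * d ! r) = a mod d ! t" if "t \<le> s" for t
    using that
  proof (induction t)
    case 0
    then show ?case using d by (simp add: d_sequence_def)
  next
    case (Suc t)
    then have "d ! t dvd d ! Suc t" using d s by (simp add: d_sequence_def)
    then have "a mod d ! t = a mod d ! Suc t mod d ! t" by (simp add: mod_mod_cancel)
    then have "a mod d ! t + a mod d ! Suc t div d ! t * d ! t = a mod d ! Suc t"
      by (metis add.commute div_mult_mod_eq)
    then show ?case using Suc by (simp add: c_def)
  qed
  have "c t < d ! Suc t div d ! t" if "t < s" for t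
  proof -
    have "d ! t dvd d ! Suc t" using d s that by (simp add: d_sequence_def)
    moreover have "a mod d ! Suc t < d ! Suc t" using d_sequence_pos[OF d] s that by simp
    ultimately show ?thesis using that by (simp add: c_def less_mult_imp_div_less)
  qed
  \<comment> \<open>The unreduced top digit \<open>a div d ! s\<close> supplies what the partial sum
    \<open>a mod d ! s\<close> lacks.\<close>
  moreover have "(\<Sum>r<Suc s. c r * d ! r) = a" using partial[of s] by (simp add: c_def mod_div_mult_eq)
  moreover have "map c [0..<Suc s] ! r = c r" if "r < Suc s" for r
    using that by (simp del: upt_Suc)
  ultimately have "d_decomposition d a (map c [0..<Suc s])"
    unfolding d_decomposition_def s by (simp del: upt_Suc sum.lessThan_Suc)
  then show ?thesis ..
qed

lemma d_le_refl: "d_sequence d \<Longrightarrow> d_le d a a"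
  using d_decomposition_exists unfolding d_le_def by blast

lemma D_fixed_transfer:
  fixes I :: "('n::linorder, 'k::comm_ring_1) mpoly set"
  assumes I: "D_fixed I" and w: "monomial (w + Poly_Mapping.single j k) \<in> I" and "i \<le> j"
    and N: "Poly_Mapping.lookup w j + k \<le> N"
  shows "monomial (w + Poly_Mapping.single i N) \<in> I"
proof -
  obtain F where F: "\<And>J. J \<in> F \<Longrightarrow> \<exists>d. d_sequence d \<and> d_fixed d J" and I_F: "I = ideal_gen (\<Union>F)"
    using I by (auto simp: D_fixed_def)
  show ?thesis
  proof (cases "i = j")
    case True
    then have "w + Poly_Mapping.single i N
        = w + Poly_Mapping.single j k + Poly_Mapping.single j (N - k)"
      using N by (simp add: add.assoc flip: single_add)
    then show ?thesis using w monomial_in_ideal_gen_add unfolding I_F by metis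
  next
    case False
    then have "i < j" using \<open>i \<le> j\<close> by simp
    let ?u = "w + Poly_Mapping.single j k"
    \<comment> \<open>The full exponent, so that reflexivity of \<open>d_le d\<close> permits the
      trade for whichever \<open>d\<close> belongs to the summand.\<close>
    let ?t = "Poly_Mapping.lookup ?u j"
    obtain J where J: "J \<in> F" "monomial ?u \<in> J"
      using monomial_in_sum_ideals[of F ?u] w F unfolding I_F d_fixed_def by blast
    then obtain d where "d_sequence d" "d_fixed d J" using F by blast
    then have "monomial (?u + Poly_Mapping.single i ?t - Poly_Mapping.single j ?t) \<in> J"
      using J(2) \<open>i < j\<close> d_le_refl unfolding d_fixed_def by blast
    then have "monomial (?u + Poly_Mapping.single i ?t - Poly_Mapping.single j ?t) \<in> I"
      unfolding I_F using J(1) by (blast intro: ideal_gen_base)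
    \<comment> \<open>The trade also strips the power of the variable \<open>j\<close> already in
      \<open>w\<close>; it is multiplied back, and \<open>?t \<le> N\<close> makes
      \<open>N - ?t\<close> exact.\<close>
    moreover have "w + Poly_Mapping.single i N
      = (?u + Poly_Mapping.single i ?t - Poly_Mapping.single j ?t)
        + (Poly_Mapping.single i (N - ?t) + Poly_Mapping.single j (Poly_Mapping.lookup w j))"
      using \<open>i < j\<close> N
      by (intro poly_mapping_eqI) (auto simp: lookup_add lookup_minus lookup_single when_def)
    ultimately show ?thesis using monomial_in_ideal_gen_add unfolding I_F by metis
  qed
qed

theorem proposition2p3:
  fixes I :: "('n::{finite,linorder}, 'k::field) mpoly set"
  assumes "infinite (UNIV :: 'k set)"
    and "CARD('n) \<ge> 2"
    and "D_fixed I"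
  shows "borel_type I"
proof -
  have I: "monomial_ideal I" using assms(3) by (simp add: D_fixed_def)
  then obtain B where I_B: "I = ideal_gen B" by (auto simp: monomial_ideal_def)
  have "f \<in> saturation I (ideal_gen (var ` {..j}))" if f: "f \<in> saturation I (ideal_gen {var j})" for f j
  proof -
    obtain k where "\<forall>g. g \<in> ideal_pow (ideal_gen {var j}) k \<longrightarrow> f * g \<in> I"
      using f by (auto simp: saturation_def ideal_colon_def)
    moreover have "var j ^ k \<in> ideal_pow (ideal_gen {var j :: ('n, 'k) mpoly}) k"
      by (intro power_in_ideal_pow ideal_gen_base) simp
    ultimately have fk: "f * monomial (Poly_Mapping.single j k) \<in> I"
      unfolding var_power by blast
    \<comment> \<open>The sum dominates each of its terms, giving one bound for all monomials of
      \<open>f\<close>; \<open>Suc\<close> keeps \<open>N\<close> positive even for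
      \<open>f = 0\<close>, as \<open>saturation\<close> starts at exponent 1.\<close>
    define N where "N = Suc (\<Sum>w\<in>Poly_Mapping.keys f. Poly_Mapping.lookup w j + k)"
    have fN: "f * var i ^ N \<in> ideal_gen B" if "i \<le> j" for i
    proof (rule mult_mem_ideal_gen)
      fix w assume w: "w \<in> Poly_Mapping.keys f"
      then have "w + Poly_Mapping.single j k \<in> Poly_Mapping.keys (f * monomial (Poly_Mapping.single j k))"
        by (simp add: in_keys_iff lookup_mult_monomial)
      then have "monomial (w + Poly_Mapping.single j k) \<in> I" by (rule monomial_ideal_keys[OF I fk])
      moreover have "Poly_Mapping.lookup w j + k \<le> N"
        unfolding N_def using w by (intro le_SucI member_le_sum) auto
      ultimately have "monomial (w + Poly_Mapping.single i N) \<in> I"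
        using D_fixed_transfer[OF assms(3)] that by blast
      then show "monomial w * var i ^ N \<in> ideal_gen B"
        by (simp add: var_power flip: I_B monomial_add)
    qed
    let ?A = "var ` {..j} :: ('n, 'k) mpoly set"
    \<comment> \<open>Pigeonhole: a product of \<open>card ?A * N\<close> variables from
      \<open>?A\<close> contains the \<open>N\<close>-th power of one of them.\<close>
    from fN have "f * g \<in> I" if "g \<in> ideal_pow (ideal_gen ?A) (\<Sum>a\<in>?A. N)" for g
      unfolding I_B by (intro mult_ideal_pow_subset[where A = ?A and e = "\<lambda>_. N", OF _ _ _ that]) auto
    then have "f \<in> ideal_colon I (ideal_pow (ideal_gen ?A) (\<Sum>a\<in>?A. N))"
      by (simp add: ideal_colon_def)
    moreover have "(\<Sum>a\<in>?A. N) \<ge> 1"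
      by (simp add: N_def Suc_le_eq card_gt_0_iff)
    ultimately show "f \<in> saturation I (ideal_gen ?A)"
      unfolding saturation_def by blast
  qed
  \<comment> \<open>The converse inclusion: \<open>var j\<close> is among the generators on the
    right, and saturation reverses inclusions.\<close>
  moreover have "ideal_gen {var j} \<subseteq> ideal_gen (var ` {..j})" for j :: 'n
    by (intro ideal_gen_mono) simp
  then have "saturation I (ideal_gen (var ` {..j})) \<subseteq> saturation I (ideal_gen {var j})" for j
    by (rule saturation_antimono)
  ultimately show ?thesis using I by (auto simp: borel_type_def)
qed

end
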